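(* Let $D$ be a complete valued division ring of characteristic $0$, let $x_0,h\in D$, and let $f:D\to D$ be differentiable in the Gâteaux sense at $x_0$ up to any order (so that the Gâteaux derivatives $\partial^k f$ are defined). Let $n\ge1$. If $$f(x_0)=\partial f(x_0)(h)=\partial^2 f(x_0)(h)=\dots=\partial^n f(x_0)(h)=0,$$ then for real $t\to0$ the expression $f(x_0+th)$ is infinitesimal of order higher than $n$ with respect to $t$: $$f(x_0+th)=o(t^n),\quad\text{i.e. } \lim_{t\to0}\frac{|f(x_0+th)|}{|t|^n}=0 .$$
   Context: A valued division ring has an absolute value with $|a|\ge0$, $|a|=0\iff a=0$, $|ab|=|a||b|$, $|a+b|\le|a|+|b|$, restricting to the usual absolute value on $\mathbb Q$; by completeness $\mathbb R\subset Z(D)$. The Gâteaux derivative of $f$ at $x$ is the $\mathbb R$-linear map $a\mapsto\partial f(x)(a)$ with $f(x+ta)-f(x)=t\,\partial f(x)(a)+o(t)$ for real $t\to0$, i.e. $\partial f(x)(a)=\lim_{t\to0}t^{-1}(f(x+ta)-f(x))$. Higher derivatives are defined inductively, $\partial^0f(x)=f(x)$, $\partial^k f(x)(a_1;\dots;a_k)=\partial\big(\partial^{k-1}f(x)(a_1;\dots;a_{k-1})\big)(a_k)$, where $\partial^{k-1}f(x)(a_1;\dots;a_{k-1})$ is differentiated as a function of $x$; $\partial^kf(x)(h)$ denotes $\partial^kf(x)(h;\dots;h)$. Differentiability at $x_0$ up to any order includes that all lower-order derivatives are defined in a neighbourhood of $x_0$. *)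

theory Defs
  imports Complex_Main
begin

text \<open>
  A complete valued division ring of characteristic 0, whose absolute value extends the usual one
  on the rationals, contains the reals in its centre.  Together with this canonical real structure
  it is a type of sort \<open>{real_normed_div_algebra, banach}\<close>: \<open>norm\<close> is the multiplicative absolute
  value, \<open>t *\<^sub>R a = of_real t * a = a * of_real t\<close>, and \<open>norm (of_real t) = \<bar>t\<bar>\<close>.
  Conversely, every such type is a complete valued division ring of characteristic 0.
  The derivatives below only use the underlying normed real vector space.
\<close>

definition has_gateaux_derivative ::
    "('a::real_normed_vector \<Rightarrow> 'b::real_normed_vector) \<Rightarrow> ('a \<Rightarrow> 'b) \<Rightarrow> 'a \<Rightarrow> bool" where
  "has_gateaux_derivative f A x \<longleftrightarrow>
     linear A \<and> (\<forall>a. ((\<lambda>t::real. (f (x + t *\<^sub>R a) - f x) /\<^sub>R t) \<longlongrightarrow> A a) (at 0))"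

definition gateaux_differentiable ::
    "('a::real_normed_vector \<Rightarrow> 'b::real_normed_vector) \<Rightarrow> 'a \<Rightarrow> bool" where
  "gateaux_differentiable f x \<longleftrightarrow> (\<exists>A. has_gateaux_derivative f A x)"

definition gateaux_deriv ::
    "('a::real_normed_vector \<Rightarrow> 'b::real_normed_vector) \<Rightarrow> 'a \<Rightarrow> 'a \<Rightarrow> 'b" where
  "gateaux_deriv f x a = Lim (at 0) (\<lambda>t::real. (f (x + t *\<^sub>R a) - f x) /\<^sub>R t)"

lemma has_gateaux_derivative_imp_deriv:
  "has_gateaux_derivative f A x \<Longrightarrow> gateaux_deriv f x = A"
  by (auto simp: has_gateaux_derivative_def gateaux_deriv_def fun_eq_iff intro!: tendsto_Lim)

text \<open>
  \<open>higher_gateaux_deriv f [a\<^sub>1, \<dots>, a\<^sub>k] x\<close> is the \<open>k\<close>-th derivative of \<open>f\<close> at \<open>x\<close> evaluated at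
  \<open>(a\<^sub>1; \<dots>; a\<^sub>k)\<close>; the order \<open>k\<close> is the length of the list.
\<close>

definition higher_gateaux_deriv ::
    "('a::real_normed_vector \<Rightarrow> 'b::real_normed_vector) \<Rightarrow> 'a list \<Rightarrow> 'a \<Rightarrow> 'b" where
  "higher_gateaux_deriv f as = foldl (\<lambda>g a x. gateaux_deriv g x a) f as"

lemma higher_gateaux_deriv_Nil: "higher_gateaux_deriv f [] x = f x"
  by (simp add: higher_gateaux_deriv_def)

lemma higher_gateaux_deriv_snoc:
  "higher_gateaux_deriv f (as @ [a]) x = gateaux_deriv (\<lambda>y. higher_gateaux_deriv f as y) x a"
  by (simp add: higher_gateaux_deriv_def)

text \<open>
  As \<open>gateaux_deriv\<close> is total, definedness of the derivatives is tracked separately: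
  \<open>gateaux_defined k f x\<close> says that the derivatives of orders up to \<open>k\<close> exist at \<open>x\<close>, that is,
  those of orders \<open>j < k\<close> are differentiable there in all their directions.
\<close>

definition gateaux_defined ::
    "nat \<Rightarrow> ('a::real_normed_vector \<Rightarrow> 'b::real_normed_vector) \<Rightarrow> 'a \<Rightarrow> bool" where
  "gateaux_defined k f x \<longleftrightarrow>
     (\<forall>as. length as < k \<longrightarrow> gateaux_differentiable (higher_gateaux_deriv f as) x)"

definition gateaux_differentiable_order ::
    "nat \<Rightarrow> ('a::real_normed_vector \<Rightarrow> 'b::real_normed_vector) \<Rightarrow> 'a \<Rightarrow> bool" where
  "gateaux_differentiable_order k f x \<longleftrightarrow>
     gateaux_defined k f x \<and> (\<forall>j<k. \<forall>\<^sub>F y in nhds x. gateaux_defined j f y)"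

end

theory Submission
  imports Defs "HOL-Analysis.Derivative"
begin

text \<open>
  Only the line through \<open>x0\<close> in the direction \<open>h\<close> matters.  The functions
  \<open>g\<^sub>j(t) = \<partial>\<^sup>j f(x0 + t h)(h)\<close> of a real variable form a chain: \<open>g\<^sub>j\<close> has derivative \<open>g\<^sub>j\<^sub>+\<^sub>1\<close>
  near \<open>0\<close> for \<open>j < n\<close> (lemma \<open>gateaux_line_derivative\<close>), and all of them up to \<open>g\<^sub>n\<close> vanish at \<open>0\<close>.
  Since \<open>g\<^sub>n\<close> is differentiable, hence continuous, at \<open>0\<close>, it is \<open>o(1)\<close>.  Each step down the chain
  gains one power of \<open>t\<close>: by the mean value inequality, a primitive of an \<open>o(t\<^sup>m)\<close> function that
  vanishes at \<open>0\<close> is \<open>o(t\<^sup>m\<^sup>+\<^sup>1)\<close> (lemma \<open>primitive_small_o_power\<close>).  After \<open>n\<close> steps,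
  \<open>g\<^sub>0(t) = f(x0 + t h)\<close> is \<open>o(t\<^sup>n)\<close>.
\<close>

text \<open>
  Restricted to a line, the difference quotient of the Gateaux derivative is the ordinary one;
  this makes the mean value inequality for curves applicable.
\<close>

lemma gateaux_line_derivative:
  fixes f :: "'a::real_normed_vector \<Rightarrow> 'b::real_normed_vector"
  assumes "gateaux_differentiable f (x + s *\<^sub>R h)"
  shows "((\<lambda>t. f (x + t *\<^sub>R h)) has_vector_derivative gateaux_deriv f (x + s *\<^sub>R h) h) (at s)"
proof -
  let ?D = "gateaux_deriv f (x + s *\<^sub>R h) h"
  let ?q = "\<lambda>t. (f (x + s *\<^sub>R h + t *\<^sub>R h) - f (x + s *\<^sub>R h)) /\<^sub>R t"
  have "(?q \<longlongrightarrow> ?D) (at 0)"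
    using assms has_gateaux_derivative_imp_deriv
    unfolding gateaux_differentiable_def has_gateaux_derivative_def by metis
  then have "((\<lambda>t. norm (?q t - ?D)) \<longlongrightarrow> 0) (at 0)"
    using LIM_zero tendsto_norm_zero by blast
  moreover have "norm (?q t - ?D)
      = norm (f (x + (s + t) *\<^sub>R h) - f (x + s *\<^sub>R h) - t *\<^sub>R ?D) / norm t" if "t \<noteq> 0" for t
  proof -
    have "f (x + (s + t) *\<^sub>R h) - f (x + s *\<^sub>R h) - t *\<^sub>R ?D = t *\<^sub>R (?q t - ?D)"
      using that by (simp add: algebra_simps)
    then show ?thesis
      using that by simp
  qed
  ultimately have "((\<lambda>t. norm (f (x + (s + t) *\<^sub>R h) - f (x + s *\<^sub>R h) - t *\<^sub>R ?D) / norm t)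
      \<longlongrightarrow> 0) (at 0)"
    by (simp cong: LIM_cong)
  then show ?thesis
    by (simp add: has_vector_derivative_def has_derivative_at bounded_linear_scaleR_left)
qed

text \<open>
  On the ball of radius \<open>\<bar>t\<bar>\<close> the derivative is at most \<open>e \<bar>t\<bar>\<^sup>m\<close>, so the mean value inequality
  bounds the increment from \<open>0\<close> to \<open>t\<close> by \<open>e \<bar>t\<bar>\<^sup>m \<bar>t\<bar>\<close>.
\<close>

lemma primitive_small_o_power:
  fixes \<phi> \<psi> :: "real \<Rightarrow> 'b::real_normed_vector"
  assumes deriv: "\<forall>\<^sub>F t in nhds 0. (\<phi> has_vector_derivative \<psi> t) (at t)"
    and "\<phi> 0 = 0" "\<psi> 0 = 0"
    and small: "((\<lambda>t. norm (\<psi> t) / \<bar>t\<bar> ^ m) \<longlongrightarrow> 0) (at 0)"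
  shows "((\<lambda>t. norm (\<phi> t) / \<bar>t\<bar> ^ Suc m) \<longlongrightarrow> 0) (at 0)"
proof (rule tendstoI)
  fix e :: real
  assume "e > 0"
  then have "\<forall>\<^sub>F t in at 0. norm (\<psi> t) / \<bar>t\<bar> ^ m < e / 2"
    using order_tendstoD(2)[OF small, of "e / 2"] by simp
  then obtain d1 where d1: "d1 > 0" "\<And>t. t \<noteq> 0 \<Longrightarrow> \<bar>t\<bar> < d1 \<Longrightarrow> norm (\<psi> t) / \<bar>t\<bar> ^ m < e / 2"
    unfolding eventually_at by (auto simp: dist_norm)
  obtain d2 where d2: "d2 > 0" "\<And>t. \<bar>t\<bar> < d2 \<Longrightarrow> (\<phi> has_vector_derivative \<psi> t) (at t)"
    using deriv unfolding eventually_nhds_metric by (auto simp: dist_norm)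
  have "norm (\<phi> t) / \<bar>t\<bar> ^ Suc m < e" if t: "t \<noteq> 0" "\<bar>t\<bar> < d1" "\<bar>t\<bar> < d2" for t
  proof -
    have bound: "norm (\<psi> u) \<le> e / 2 * \<bar>t\<bar> ^ m" if "\<bar>u\<bar> \<le> \<bar>t\<bar>" for u
    proof (cases "u = 0")
      case True
      then show ?thesis
        using \<open>\<psi> 0 = 0\<close> \<open>e > 0\<close> by simp
    next
      case False
      then have "norm (\<psi> u) \<le> e / 2 * \<bar>u\<bar> ^ m"
        using d1(2)[of u] that t(2) by (simp add: field_simps)
      also have "\<dots> \<le> e / 2 * \<bar>t\<bar> ^ m"
        using that \<open>e > 0\<close> by (intro mult_left_mono power_mono) auto
      finally show ?thesis .
    qed
    have "norm (\<phi> t - \<phi> 0) \<le> (e / 2 * \<bar>t\<bar> ^ m) * norm (t - 0)"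
    proof (rule differentiable_bound[of "cball 0 \<bar>t\<bar>"])
      fix u :: real
      assume u: "u \<in> cball 0 \<bar>t\<bar>"
      then show "(\<phi> has_derivative (\<lambda>s. s *\<^sub>R \<psi> u)) (at u within cball 0 \<bar>t\<bar>)"
        using d2(2)[of u] t(3)
        by (simp add: has_vector_derivative_def has_derivative_at_withinI)
      show "onorm (\<lambda>s. s *\<^sub>R \<psi> u) \<le> e / 2 * \<bar>t\<bar> ^ m"
      proof (rule onorm_le)
        fix s :: real
        have "\<bar>s\<bar> * norm (\<psi> u) \<le> \<bar>s\<bar> * (e / 2 * \<bar>t\<bar> ^ m)"
          using bound[of u] u by (intro mult_left_mono) auto
        then show "norm (s *\<^sub>R \<psi> u) \<le> e / 2 * \<bar>t\<bar> ^ m * norm s"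
          by (simp add: mult.commute)
      qed
    qed auto
    then have "norm (\<phi> t) / \<bar>t\<bar> ^ Suc m \<le> e / 2"
      using t(1) \<open>\<phi> 0 = 0\<close> by (simp add: field_simps)
    then show ?thesis
      using \<open>e > 0\<close> by linarith
  qed
  then show "\<forall>\<^sub>F t in at 0. dist (norm (\<phi> t) / \<bar>t\<bar> ^ Suc m) 0 < e"
    unfolding eventually_at using d1(1) d2(1)
    by (intro exI[of _ "min d1 d2"]) (auto simp: dist_norm)
qed

theorem theorem8p2p6:
  fixes f :: "'a::{real_normed_div_algebra, banach} \<Rightarrow> 'a"
    and x0 h :: 'a and n :: nat
  assumes "\<And>k. gateaux_differentiable_order k f x0"
    and "n \<ge> 1"
    and "\<And>k. k \<le> n \<Longrightarrow> higher_gateaux_deriv f (replicate k h) x0 = 0"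
  shows "((\<lambda>t::real. norm (f (x0 + t *\<^sub>R h)) / \<bar>t\<bar> ^ n) \<longlongrightarrow> 0) (at 0)"
proof -
  define g where "g j t = higher_gateaux_deriv f (replicate j h) (x0 + t *\<^sub>R h)" for j and t :: real
  have g_deriv: "(g j has_vector_derivative g (Suc j) t) (at t)"
    if "gateaux_defined (Suc j) f (x0 + t *\<^sub>R h)" for j t
  proof -
    have "gateaux_differentiable (higher_gateaux_deriv f (replicate j h)) (x0 + t *\<^sub>R h)"
      using that by (simp add: gateaux_defined_def)
    from gateaux_line_derivative[OF this] show ?thesis
      using higher_gateaux_deriv_snoc[of f "replicate j h" h]
      by (simp add: g_def[abs_def] replicate_append_same)
  qed
  have g_zero: "g j 0 = 0" if "j \<le> n" for j
    using assms(3) that by (simp add: g_def)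
  have g_chain: "\<forall>\<^sub>F t in nhds 0. (g j has_vector_derivative g (Suc j) t) (at t)" for j
  proof -
    \<comment> \<open>Differentiability of order \<open>k\<close> gives derivatives in a neighbourhood only below \<open>k\<close>,
      and \<open>g (Suc j)\<close> itself must exist there, hence \<open>k = j + 2\<close>.\<close>
    have "\<forall>\<^sub>F y in nhds x0. gateaux_defined (Suc j) f y"
      using assms(1)[of "Suc (Suc j)"] by (simp add: gateaux_differentiable_order_def)
    moreover have "((\<lambda>t. x0 + t *\<^sub>R h) \<longlongrightarrow> x0) (nhds 0)"
      by (auto intro!: tendsto_eq_intros filterlim_ident)
    ultimately have "\<forall>\<^sub>F t in nhds 0. gateaux_defined (Suc j) f (x0 + t *\<^sub>R h)"
      by (rule eventually_compose_filterlim)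
    then show ?thesis
      by eventually_elim (rule g_deriv)
  qed
  have "((\<lambda>t. norm (g (n - m) t) / \<bar>t\<bar> ^ m) \<longlongrightarrow> 0) (at 0)" if "m \<le> n" for m
    using that
  proof (induction m)
    case 0
    have "continuous (at 0) (g n)"
      using eventually_nhds_x_imp_x[OF g_chain] by (rule has_vector_derivative_continuous)
    then have "(g n \<longlongrightarrow> 0) (at 0)"
      by (simp add: continuous_at g_zero)
    then show ?case
      by (simp add: tendsto_norm_zero)
  next
    case (Suc m)
    then have "Suc (n - Suc m) = n - m"
      by simp
    with Suc show ?case
      using g_chain[of "n - Suc m"]
      by (intro primitive_small_o_power[where \<psi> = "g (n - m)"]) (auto intro: g_zero)
  qed
  from this[of n] show ?thesis
    by (simp add: g_def higher_gateaux_deriv_Nil)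
qed

end
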